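(* Let $(X,*_0,*_1)$ be mutually distributive racks, i.e. $(X,*_0)$ and $(X,*_1)$ are racks on the same set $X$ and $*_0,*_1$ are mutually distributive. For $(x_0,x_1),(y_0,y_1)\in X\times X$ define $$(x_0,x_1)*(y_0,y_1):=\bigl((x_0*_0y_0)*_1y_1,\ (x_1*_0y_0)*_1y_1\bigr).$$ Then $(X\times X,* )$ is a rack.
   Context: A rack $(X,* )$ is a set with a binary operation such that $(a*b)*c=(a*c)*(b*c)$ for all $a,b,c\in X$, and for every $y\in X$ the map $R_y:x\mapsto x*y$ is a bijection of $X$. Two self-distributive binary operations $*_0,*_1$ on $X$ are mutually distributive if $(x*_0y)*_1z=(x*_1z)*_0(y*_1z)$ and $(x*_1y)*_0z=(x*_0z)*_1(y*_0z)$ for all $x,y,z\in X$. *)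

theory Defs
  imports Main
begin

definition binary_operation_on :: "'a set \<Rightarrow> ('a \<Rightarrow> 'a \<Rightarrow> 'a) \<Rightarrow> bool" where
  "binary_operation_on X f \<longleftrightarrow> (\<forall>a\<in>X. \<forall>b\<in>X. f a b \<in> X)"

definition self_distributive_on :: "'a set \<Rightarrow> ('a \<Rightarrow> 'a \<Rightarrow> 'a) \<Rightarrow> bool" where
  "self_distributive_on X f \<longleftrightarrow>
     (\<forall>a\<in>X. \<forall>b\<in>X. \<forall>c\<in>X. f (f a b) c = f (f a c) (f b c))"

definition rack :: "'a set \<Rightarrow> ('a \<Rightarrow> 'a \<Rightarrow> 'a) \<Rightarrow> bool" where
  "rack X f \<longleftrightarrow>
     binary_operation_on X f \<and>
     self_distributive_on X f \<and>
     (\<forall>y\<in>X. bij_betw (\<lambda>x. f x y) X X)"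

definition mutually_distributive_on ::
    "'a set \<Rightarrow> ('a \<Rightarrow> 'a \<Rightarrow> 'a) \<Rightarrow> ('a \<Rightarrow> 'a \<Rightarrow> 'a) \<Rightarrow> bool" where
  "mutually_distributive_on X f g \<longleftrightarrow>
     binary_operation_on X f \<and> binary_operation_on X g \<and>
     self_distributive_on X f \<and> self_distributive_on X g \<and>
     (\<forall>x\<in>X. \<forall>y\<in>X. \<forall>z\<in>X. g (f x y) z = f (g x z) (g y z)) \<and>
     (\<forall>x\<in>X. \<forall>y\<in>X. \<forall>z\<in>X. f (g x y) z = g (f x z) (f y z))"

definition pair_operation ::
    "('a \<Rightarrow> 'a \<Rightarrow> 'a) \<Rightarrow> ('a \<Rightarrow> 'a \<Rightarrow> 'a) \<Rightarrow> 'a \<times> 'a \<Rightarrow> 'a \<times> 'a \<Rightarrow> 'a \<times> 'a" where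
  "pair_operation f g = (\<lambda>(x0, x1) (y0, y1). (g (f x0 y0) y1, g (f x1 y0) y1))"

end

theory Submission
  imports Defs
begin

text \<open>
  Right translation by \<open>(c0, c1)\<close> acts on both coordinates by the single map
  \<open>x \<mapsto> (x *\<^sub>0 c0) *\<^sub>1 c1\<close>. As a composite of right translations it is a bijection of \<open>X\<close>,
  and by self-distributivity and mutual distributivity it is an endomorphism of both operations.
\<close>

lemma rack_closed:
  assumes "rack X f" "a \<in> X" "b \<in> X"
  shows "f a b \<in> X"
  using assms unfolding rack_def binary_operation_on_def by blast

lemma rack_self_distributive:
  assumes "rack X f" "a \<in> X" "b \<in> X" "c \<in> X"
  shows "f (f a b) c = f (f a c) (f b c)"
  using assms unfolding rack_def self_distributive_on_def by blast

lemma bij_betw_rack_translation: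
  assumes "rack X f" "y \<in> X"
  shows "bij_betw (\<lambda>x. f x y) X X"
  using assms unfolding rack_def by blast

lemma mutually_distributive_onD:
  assumes "mutually_distributive_on X f g" "x \<in> X" "y \<in> X" "z \<in> X"
  shows "g (f x y) z = f (g x z) (g y z)" "f (g x y) z = g (f x z) (f y z)"
  using assms unfolding mutually_distributive_on_def by blast+

theorem lemma6p1:
  fixes X :: "'a set" and op0 op1 :: "'a \<Rightarrow> 'a \<Rightarrow> 'a"
  assumes "rack X op0"
    and "rack X op1"
    and "mutually_distributive_on X op0 op1"
  shows "rack (X \<times> X) (pair_operation op0 op1)"
proof -
  define h where "h c0 c1 x = op1 (op0 x c0) c1" for c0 c1 x
  have pair: "pair_operation op0 op1 p (c0, c1) = map_prod (h c0 c1) (h c0 c1) p" for p c0 c1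
    by (cases p) (simp add: pair_operation_def h_def)
  note closed = rack_closed[OF assms(1)] rack_closed[OF assms(2)]
  have h_closed: "h c0 c1 x \<in> X" if "c0 \<in> X" "c1 \<in> X" "x \<in> X" for c0 c1 x
    using that by (simp add: h_def closed)
  \<comment> \<open>Push \<open>c0\<close> inside by self-distributivity of \<open>op0\<close>, then
    \<open>c1\<close> by mutual distributivity. The self-distributive law is instantiated because
    its right-hand side matches its left-hand side again, so as a general rewrite rule it would
    loop.\<close>
  have h_op0: "h c0 c1 (op0 x y) = op0 (h c0 c1 x) (h c0 c1 y)"
    if "c0 \<in> X" "c1 \<in> X" "x \<in> X" "y \<in> X" for c0 c1 x y
    using that by (simp add: h_def closed rack_self_distributive[OF assms(1), of x y c0]
        mutually_distributive_onD(1)[OF assms(3), of _ _ c1])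
  \<comment> \<open>The two laws swap roles: \<open>c0\<close> now passes through \<open>op1\<close>
    by mutual distributivity, \<open>c1\<close> by self-distributivity.\<close>
  have h_op1: "h c0 c1 (op1 x y) = op1 (h c0 c1 x) (h c0 c1 y)"
    if "c0 \<in> X" "c1 \<in> X" "x \<in> X" "y \<in> X" for c0 c1 x y
    using that by (simp add: h_def closed mutually_distributive_onD(2)[OF assms(3), of x y c0]
        rack_self_distributive[OF assms(2), of "op0 x c0" "op0 y c0" c1])
  \<comment> \<open>An endomorphism of both operations preserves every term built from them, in
    particular \<open>op1 (op0 x b0) b1\<close>. Only the inner \<open>h\<close> and the resulting
    one are unfolded, so that \<open>h c0 c1\<close> stays intact for the two endomorphism
    laws.\<close>
  have h_h: "h c0 c1 (h b0 b1 x) = h (h c0 c1 b0) (h c0 c1 b1) (h c0 c1 x)"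
    if "c0 \<in> X" "c1 \<in> X" "b0 \<in> X" "b1 \<in> X" "x \<in> X" for b0 b1 c0 c1 x
    using that h_op1[of c0 c1 "op0 x b0" b1] h_op0[of c0 c1 x b0]
    by (simp add: h_def[of b0 b1] h_def[of "h c0 c1 b0" "h c0 c1 b1"] closed)
  have h_bij: "bij_betw (h c0 c1) X X" if "c0 \<in> X" "c1 \<in> X" for c0 c1
    using bij_betw_trans[OF bij_betw_rack_translation[OF assms(1) that(1)]
        bij_betw_rack_translation[OF assms(2) that(2)]]
    by (simp add: h_def[abs_def] comp_def)
  have "binary_operation_on (X \<times> X) (pair_operation op0 op1)"
    by (auto simp: binary_operation_on_def pair h_closed)
  \<comment> \<open>In each coordinate, self-distributivity of the pair operation is exactly
    \<open>h_h\<close>.\<close>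
  moreover have "self_distributive_on (X \<times> X) (pair_operation op0 op1)"
    by (auto simp: self_distributive_on_def pair intro: h_h)
  moreover have "\<forall>p\<in>X \<times> X. bij_betw (\<lambda>q. pair_operation op0 op1 q p) (X \<times> X) (X \<times> X)"
    by (auto simp: pair intro!: bij_betw_map_prod h_bij)
  ultimately show ?thesis
    unfolding rack_def by blast
qed

end
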